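(* Let $\mathbb{K}$ be a field of characteristic $0$ and let $S$ be a $\mathbb{K}$-algebra which is a Poisson $C$-order. Let $\mathrm{tr}:S\to C$ be a trace map that commutes with all derivations of $S$ that preserve $C$. (i) If $S$ is a free $C$-module (of finite rank), then $d(S/C)$ is a Poisson normal element of $C$. If, in addition, $C$ is a unique factorization domain as a commutative algebra or a noetherian Poisson unique factorization domain, then either $d(S/C)=0$ or $$d(S/C)=_{C^\times}\prod_{i=1}^m p_i$$ for some (not necessarily distinct) Poisson prime elements $p_1,\dots,p_m\in C$ (a product of $0$ primes is $1$). (ii) For all positive integers $n$, the discriminant and modified discriminant ideals $D_n(S/C)$ and $MD_n(S/C)$ are Poisson ideals of $C$. Furthermore, $\partial(D_n(S/C))\subseteq D_n(S/C)$ and $\partial(MD_n(S/C))\subseteq MD_n(S/C)$ for all derivations $\partial$ of $S$ such that $\partial(C)\subseteq C$.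
   Context: All algebras are unital; derivations are $\mathbb{K}$-linear. Poisson order (Brown–Gordon): $S$ is an affine (finitely generated) $\mathbb{K}$-algebra that is a finite module over a central subalgebra $C$; it is a Poisson $C$-order if there is a $\mathbb{K}$-linear map $\Delta:C\to\mathrm{Der}_{\mathbb{K}}(S)$, $z\mapsto\Delta_z$, such that $C$ is stable under $\Delta_z$ for all $z\in C$ and the bracket $\{z_1,z_2\}:=\Delta_{z_1}(z_2)$ makes $C$ a Poisson algebra. A trace $\mathrm{tr}:S\to C$ is a $C$-linear map with $\mathrm{tr}(xy)=\mathrm{tr}(yx)$; it commutes with $\partial$ if $\mathrm{tr}(\partial x)=\partial(\mathrm{tr}(x))$ for all $x$. $D_n(S/C)$ is the ideal of $C$ generated by $\det([\mathrm{tr}(y_iy_j)]_{i,j=1}^n)$ over all $n$-element subsets $\{y_1,\dots,y_n\}\subset S$; $MD_n(S/C)$ is the ideal of $C$ generated by $\det([\mathrm{tr}(x_iy_j)]_{i,j=1}^n)$ over all $(x_i),(y_j)\in S^n$. If $S$ is free of rank $N$ over $C$, $d(S/C):=\det([\mathrm{tr}(y_iy_j)]_{i,j=1}^N)$ for a $C$-basis $\{y_i\}$, where here $\mathrm{tr}$ is the canonical trace obtained by composing the embedding $S\hookrightarrow M_N(C)$ (left multiplication in a $C$-basis) with the matrix trace; it is well defined up to units of $C$. $a=_{C^\times}b$ means $a=ub$ with $u\in C^\times$. For a commutative Poisson algebra $A$: an ideal $I$ is Poisson if $\{I,A\}\subseteq I$; $a\in A$ is Poisson normal if for every $x\in A$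 there is $y\in A$ with $\{a,x\}=ay$. If $A$ is a domain, $p\in A$ is Poisson prime if it is a (nonzero) prime element of the commutative algebra $A$ and is Poisson normal. A noetherian Poisson unique factorization domain is a Poisson algebra that is noetherian and an integral domain as a commutative algebra and in which every nonzero Poisson prime ideal (prime ideal that is Poisson) contains a Poisson prime element. *)

theory Defs
  imports
    Jordan_Normal_Form.VS_Connect
    Jordan_Normal_Form.Determinant
    "HOL-Algebra.Ring_Divisibility"
begin

text \<open>
  Rings are types. The central subalgebra \<open>C \<subseteq> S\<close> is a type \<open>'c\<close> together with an injective
  algebra homomorphism \<open>\<iota>\<close> into the centre of \<open>'s\<close>; thus \<open>x \<in> S\<close> lies in \<open>C\<close> iff \<open>x \<in> range \<iota>\<close>.
  For ideals, prime ideals, the noetherian property and unique factorization of \<open>C\<close> we use the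
  notions of HOL-Algebra, applied to \<open>class_ring\<close>, the type viewed as a ring record.
  Modules are those of \<^theory>\<open>HOL.Modules\<close>, with explicit scalar multiplication. The qualifier
  \<open>Modules\<close> is needed because HOL-Algebra has a locale of the same name.
\<close>

locale k_algebra = vector_space scale
  for scale :: "'k::field \<Rightarrow> 'a::ring_1 \<Rightarrow> 'a" +
  assumes scale_mult_left: "scale r x * y = scale r (x * y)"
    and scale_mult_right: "x * scale r y = scale r (x * y)"

definition subalgebra_set :: "('k::field \<Rightarrow> 'a::ring_1 \<Rightarrow> 'a) \<Rightarrow> 'a set \<Rightarrow> bool" where
  "subalgebra_set scale A \<longleftrightarrow>
     Modules.module.subspace scale A \<and> 1 \<in> A \<and> (\<forall>x\<in>A. \<forall>y\<in>A. x * y \<in> A)"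

definition affine_algebra :: "('k::field \<Rightarrow> 'a::ring_1 \<Rightarrow> 'a) \<Rightarrow> bool" where
  "affine_algebra scale \<longleftrightarrow> (\<exists>X. finite X \<and> subalgebra_set scale hull X = UNIV)"

definition derivation :: "('k::field \<Rightarrow> 'a::ring_1 \<Rightarrow> 'a) \<Rightarrow> ('a \<Rightarrow> 'a) \<Rightarrow> bool" where
  "derivation scale \<delta> \<longleftrightarrow>
     Vector_Spaces.linear scale scale \<delta> \<and> (\<forall>x y. \<delta> (x * y) = \<delta> x * y + x * \<delta> y)"


subsection \<open>Commutative Poisson algebras\<close>

locale poisson_algebra = k_algebra scale
  for scale :: "'k::field \<Rightarrow> 'a::comm_ring_1 \<Rightarrow> 'a" +
  fixes br :: "'a \<Rightarrow> 'a \<Rightarrow> 'a"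
  assumes linear_left: "Vector_Spaces.linear scale scale (\<lambda>a. br a b)"
    and leibniz: "derivation scale (br a)"
    and alternating: "br a a = 0"
    and jacobi: "br a (br b c) + br b (br c a) + br c (br a b) = 0"

definition poisson_ideal :: "('a::comm_ring_1 \<Rightarrow> 'a \<Rightarrow> 'a) \<Rightarrow> 'a set \<Rightarrow> bool" where
  "poisson_ideal br I \<longleftrightarrow> ideal I class_ring \<and> (\<forall>x\<in>I. \<forall>a. br x a \<in> I)"

definition poisson_normal :: "('a::comm_ring_1 \<Rightarrow> 'a \<Rightarrow> 'a) \<Rightarrow> 'a \<Rightarrow> bool" where
  "poisson_normal br a \<longleftrightarrow> (\<forall>x. \<exists>y. br a x = a * y)"

definition poisson_prime :: "('a::comm_ring_1 \<Rightarrow> 'a \<Rightarrow> 'a) \<Rightarrow> 'a \<Rightarrow> bool" where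
  "poisson_prime br p \<longleftrightarrow> prime_elem p \<and> poisson_normal br p"

definition noetherian_poisson_ufd :: "('a::comm_ring_1 \<Rightarrow> 'a \<Rightarrow> 'a) \<Rightarrow> bool" where
  "noetherian_poisson_ufd br \<longleftrightarrow>
     noetherian_domain (class_ring :: 'a ring) \<and>
     (\<forall>P. primeideal P class_ring \<and> poisson_ideal br P \<and> P \<noteq> {0} \<longrightarrow>
          (\<exists>p\<in>P. poisson_prime br p))"


subsection \<open>Poisson orders and traces\<close>

locale central_subalgebra = C: k_algebra scaleC + S: k_algebra scaleS
  for scaleC :: "'k::field \<Rightarrow> 'c::comm_ring_1 \<Rightarrow> 'c"
    and scaleS :: "'k \<Rightarrow> 's::ring_1 \<Rightarrow> 's" +
  fixes \<iota> :: "'c \<Rightarrow> 's"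
  assumes inj: "inj \<iota>"
    and linear: "Vector_Spaces.linear scaleC scaleS \<iota>"
    and hom_mult: "\<iota> (a * b) = \<iota> a * \<iota> b"
    and hom_one: "\<iota> 1 = 1"
    and central: "\<iota> a * x = x * \<iota> a"

abbreviation cscale :: "('c \<Rightarrow> 's) \<Rightarrow> 'c::comm_ring_1 \<Rightarrow> 's::ring_1 \<Rightarrow> 's" where
  "cscale \<iota> \<equiv> (\<lambda>c x. \<iota> c * x)"

definition preserves_subalgebra :: "('c \<Rightarrow> 's) \<Rightarrow> ('s \<Rightarrow> 's) \<Rightarrow> bool" where
  "preserves_subalgebra \<iota> \<delta> \<longleftrightarrow> \<delta> ` range \<iota> \<subseteq> range \<iota>"

text \<open>The bracket \<open>{z, w} = \<Delta>\<^sub>z(w)\<close>, pulled back along \<open>\<iota>\<close>.\<close>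
definition order_bracket :: "('c \<Rightarrow> 's) \<Rightarrow> ('c \<Rightarrow> 's \<Rightarrow> 's) \<Rightarrow> 'c \<Rightarrow> 'c \<Rightarrow> 'c" where
  "order_bracket \<iota> \<Delta> z w = the_inv \<iota> (\<Delta> z (\<iota> w))"

locale poisson_order = central_subalgebra scaleC scaleS \<iota>
  for scaleC :: "'k::field \<Rightarrow> 'c::comm_ring_1 \<Rightarrow> 'c"
    and scaleS :: "'k \<Rightarrow> 's::ring_1 \<Rightarrow> 's"
    and \<iota> :: "'c \<Rightarrow> 's" +
  fixes \<Delta> :: "'c \<Rightarrow> 's \<Rightarrow> 's"
  assumes affine: "affine_algebra scaleS"
    and module_finite: "\<exists>X. finite X \<and> Modules.module.span (cscale \<iota>) X = UNIV"
    and \<Delta>_derivation: "derivation scaleS (\<Delta> z)"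
    and \<Delta>_add: "\<Delta> (z + w) x = \<Delta> z x + \<Delta> w x"
    and \<Delta>_scale: "\<Delta> (scaleC r z) x = scaleS r (\<Delta> z x)"
    and \<Delta>_preserves: "preserves_subalgebra \<iota> (\<Delta> z)"
    and poisson: "poisson_algebra scaleC (order_bracket \<iota> \<Delta>)"

definition trace_map :: "('c::comm_ring_1 \<Rightarrow> 's::ring_1) \<Rightarrow> ('s \<Rightarrow> 'c) \<Rightarrow> bool" where
  "trace_map \<iota> tr \<longleftrightarrow> Modules.module_hom (cscale \<iota>) (*) tr \<and> (\<forall>x y. tr (x * y) = tr (y * x))"

definition trace_commutes :: "('c \<Rightarrow> 's) \<Rightarrow> ('s \<Rightarrow> 'c) \<Rightarrow> ('s \<Rightarrow> 's) \<Rightarrow> bool" where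
  "trace_commutes \<iota> tr \<delta> \<longleftrightarrow> (\<forall>x. \<iota> (tr (\<delta> x)) = \<delta> (\<iota> (tr x)))"


subsection \<open>Discriminants and discriminant ideals\<close>

definition trace_det :: "('s::ring_1 \<Rightarrow> 'c::comm_ring_1) \<Rightarrow> nat \<Rightarrow> 's list \<Rightarrow> 's list \<Rightarrow> 'c" where
  "trace_det tr n xs ys = det (mat n n (\<lambda>(i, j). tr (xs ! i * ys ! j)))"

text \<open>An \<open>n\<close>-element subset is given by a list enumerating it without repetition; the determinant
  does not depend on the enumeration.\<close>
definition discriminant_ideal :: "('s::ring_1 \<Rightarrow> 'c::comm_ring_1) \<Rightarrow> nat \<Rightarrow> 'c set" where
  "discriminant_ideal tr n =
     genideal class_ring {trace_det tr n ys ys | ys. length ys = n \<and> distinct ys}"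

definition modified_discriminant_ideal :: "('s::ring_1 \<Rightarrow> 'c::comm_ring_1) \<Rightarrow> nat \<Rightarrow> 'c set" where
  "modified_discriminant_ideal tr n =
     genideal class_ring {trace_det tr n xs ys | xs ys. length xs = n \<and> length ys = n}"

definition module_basis :: "('c::comm_ring_1 \<Rightarrow> 's::ring_1) \<Rightarrow> 's list \<Rightarrow> bool" where
  "module_basis \<iota> ys \<longleftrightarrow> distinct ys \<and>
     \<not> Modules.module.dependent (cscale \<iota>) (set ys) \<and>
     Modules.module.span (cscale \<iota>) (set ys) = UNIV"

definition left_mult_matrix ::
    "('c::comm_ring_1 \<Rightarrow> 's::ring_1) \<Rightarrow> 's list \<Rightarrow> 's \<Rightarrow> 'c mat" where
  "left_mult_matrix \<iota> ys x = mat (length ys) (length ys)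
     (\<lambda>(i, j). Modules.module.representation (cscale \<iota>) (set ys) (x * ys ! j) (ys ! i))"

definition canonical_trace ::
    "('c::comm_ring_1 \<Rightarrow> 's::ring_1) \<Rightarrow> 's list \<Rightarrow> 's \<Rightarrow> 'c" where
  "canonical_trace \<iota> ys x = (\<Sum>i<length ys. left_mult_matrix \<iota> ys x $$ (i, i))"

text \<open>The canonical trace is independent of the basis, so using the same basis for the trace and
  for the determinant is no restriction. The element below depends on the basis
  up to units of \<open>C\<close>.\<close>
definition free_discriminant :: "('c::comm_ring_1 \<Rightarrow> 's::ring_1) \<Rightarrow> 's list \<Rightarrow> 'c" where
  "free_discriminant \<iota> ys = trace_det (canonical_trace \<iota> ys) (length ys) ys ys"

end

(* The canonical trace of a free C-algebra commutes with every derivation preserving C, so for a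
   basis with Gram matrix M and matrix B of the derivation one gets d(det M) = 2 tr(B) det M,
   which is Poisson normality. For the discriminant ideals, differentiating a Gram determinant
   replaces one vector at a time by its derivative; in the symmetric case the two resulting
   determinants agree, and polarisation writes twice such a determinant by symmetric ones.

   In a factorial domain of characteristic 0 every prime factor of a Poisson normal element is
   Poisson normal. In a Poisson UFD one argues as in Kaplansky's criterion: a Poisson ideal
   maximal among those disjoint from the multiplicative set of units times products of Poisson
   primes is radical, its colon ideals are again Poisson, hence it is prime. Thus the ideal of a
   nonzero Poisson normal element meets this set, which is saturated. *)
theory Submission
  imports Defs
begin

subsection \<open>Derivations of commutative rings and determinants\<close>

locale comm_ring_derivation =
  fixes d :: "'a::comm_ring_1 \<Rightarrow> 'a"
  assumes add: "d (a + b) = d a + d b"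
    and leibniz: "d (a * b) = d a * b + a * d b"
begin

lemma zero [simp]: "d 0 = 0"
  using add[of 0 0] by simp

lemma uminus: "d (- a) = - d a"
  using add[of a "- a"] by (simp add: eq_neg_iff_add_eq_0 add.commute)

lemma sum: "d (\<Sum>i\<in>I. f i) = (\<Sum>i\<in>I. d (f i))"
  by (induction I rule: infinite_finite_induct) (simp_all add: add)

lemma one [simp]: "d 1 = 0"
  using leibniz[of 1 1] by simp

lemma prod:
  assumes "finite I"
  shows "d (\<Prod>i\<in>I. f i) = (\<Sum>i\<in>I. d (f i) * (\<Prod>j\<in>I - {i}. f j))"
  using assms
proof (induction I)
  case (insert k I)
  have "(\<Sum>i\<in>I. d (f i) * (\<Prod>j\<in>insert k I - {i}. f j)) =
      (\<Sum>i\<in>I. f k * (d (f i) * (\<Prod>j\<in>I - {i}. f j)))"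
  proof (rule sum.cong)
    fix i assume "i \<in> I"
    then have "insert k I - {i} = insert k (I - {i})" using insert.hyps by auto
    then show "d (f i) * (\<Prod>j\<in>insert k I - {i}. f j) = f k * (d (f i) * (\<Prod>j\<in>I - {i}. f j))"
      using insert.hyps by (simp add: algebra_simps)
  qed simp
  moreover have "insert k I - {k} = I" using insert.hyps by auto
  ultimately show ?case
    using insert by (simp add: leibniz sum_distrib_left)
qed simp

lemma derivation_power_Suc: "d (a ^ Suc n) = of_nat (Suc n) * a ^ n * d a"
  by (induction n) (simp_all add: leibniz algebra_simps)

end

section \<open>Cofactor expansions and the derivative of a determinant\<close>

lemma cofactor_cong_row:
  assumes "A \<in> carrier_mat n n" "B \<in> carrier_mat n n" "i < n" "j < n"
    and "\<And>k l. k < n \<Longrightarrow> l < n \<Longrightarrow> k \<noteq> i \<Longrightarrow> A $$ (k, l) = B $$ (k, l)"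
  shows "cofactor A i j = cofactor B i j"
proof -
  have "mat_delete A i j = mat_delete B i j"
    using assms by (intro eq_matI) (auto simp: mat_delete_def)
  then show ?thesis by (simp add: cofactor_def)
qed

lemma cofactor_cong_col:
  assumes "A \<in> carrier_mat n n" "B \<in> carrier_mat n n" "i < n" "j < n"
    and "\<And>k l. k < n \<Longrightarrow> l < n \<Longrightarrow> l \<noteq> j \<Longrightarrow> A $$ (k, l) = B $$ (k, l)"
  shows "cofactor A i j = cofactor B i j"
proof -
  have "mat_delete A i j = mat_delete B i j"
    using assms by (intro eq_matI) (auto simp: mat_delete_def)
  then show ?thesis by (simp add: cofactor_def)
qed

text \<open>The cofactors of row \<open>i\<close> do not involve row \<open>i\<close>. Taking them
  from a fixed \<open>A\<close> exhibits the determinant as linear in the row that \<open>B\<close>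
  has there.\<close>

lemma det_row_expansion:
  assumes "i < n" "A \<in> carrier_mat n n" "B \<in> carrier_mat n n"
    and "\<And>k l. k < n \<Longrightarrow> l < n \<Longrightarrow> k \<noteq> i \<Longrightarrow> A $$ (k, l) = B $$ (k, l)"
  shows "det B = (\<Sum>j<n. B $$ (i, j) * cofactor A i j)"
  using assms by (subst laplace_expansion_row[of B n i])
    (auto intro!: sum.cong arg_cong2[where f="(*)"] cofactor_cong_row[symmetric])

lemma det_col_expansion:
  assumes "j < n" "A \<in> carrier_mat n n" "B \<in> carrier_mat n n"
    and "\<And>k l. k < n \<Longrightarrow> l < n \<Longrightarrow> l \<noteq> j \<Longrightarrow> A $$ (k, l) = B $$ (k, l)"
  shows "det B = (\<Sum>i<n. B $$ (i, j) * cofactor A i j)"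
  using assms by (subst laplace_expansion_column[of B n j])
    (auto intro!: sum.cong arg_cong2[where f="(*)"] cofactor_cong_col[symmetric])

text \<open>These are the entries of \<open>A\<close> times its adjugate, which is
  \<open>det A\<close> times the identity.\<close>

lemma sum_row_cofactor:
  assumes "A \<in> carrier_mat n n" "i < n" "k < n"
  shows "(\<Sum>j<n. A $$ (k, j) * cofactor A i j) = (if k = i then det A else 0)"
  using arg_cong[OF adj_mat(2)[OF assms(1)], of "\<lambda>M. M $$ (k, i)"] assms
  by (simp add: adj_mat_def scalar_prod_def atLeast0LessThan)

lemma sum_col_cofactor:
  assumes "A \<in> carrier_mat n n" "j < n" "k < n"
  shows "(\<Sum>i<n. A $$ (i, k) * cofactor A i j) = (if k = j then det A else 0)"
  using arg_cong[OF adj_mat(3)[OF assms(1)], of "\<lambda>M. M $$ (j, k)"] assms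
  by (simp add: adj_mat_def scalar_prod_def atLeast0LessThan mult.commute eq_commute[of j])

text \<open>Jacobi's formula. The product rule differentiates one factor of each permutation term at
  a time; the terms with a differentiated factor from row \<open>i\<close> add up to a determinant
  with that single row differentiated.\<close>

lemma (in comm_ring_derivation) det:
  assumes A: "A \<in> carrier_mat n n"
  shows "d (det A) = (\<Sum>i<n. \<Sum>j<n. d (A $$ (i, j)) * cofactor A i j)"
proof -
  define R where "R i = mat n n (\<lambda>(k, l). if k = i then d (A $$ (k, l)) else A $$ (k, l))" for i
  have R: "R i \<in> carrier_mat n n" for i by (simp add: R_def)
  let ?P = "{p. p permutes {0..<n}}"
  have sgn: "d (of_int (sign p) * a) = of_int (sign p) * d a" for p :: "nat \<Rightarrow> nat" and a
    by (cases "sign p = 1") (auto simp: sign_def uminus)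
  have "d (det A) = (\<Sum>p\<in>?P. \<Sum>i<n. signof p * (d (A $$ (i, p i)) * (\<Prod>k\<in>{..<n} - {i}. A $$ (k, p k))))"
    unfolding det_def'[OF A] sum by (simp add: sgn prod sum_distrib_left atLeast0LessThan)
  also have "\<dots> = (\<Sum>i<n. \<Sum>p\<in>?P. signof p * (d (A $$ (i, p i)) * (\<Prod>k\<in>{..<n} - {i}. A $$ (k, p k))))"
    by (rule sum.swap)
  also have "\<dots> = (\<Sum>i<n. det (R i))"
  proof (intro sum.cong refl)
    fix i assume i: "i \<in> {..<n}"
    have "(\<Prod>k<n. R i $$ (k, p k)) = d (A $$ (i, p i)) * (\<Prod>k\<in>{..<n} - {i}. A $$ (k, p k))"
      if p: "p permutes {0..<n}" for p
    proof -
      have less: "p k < n" if "k < n" for k using permutes_in_image[OF p, of k] that by simp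
      have "(\<Prod>k<n. R i $$ (k, p k)) = R i $$ (i, p i) * (\<Prod>k\<in>{..<n} - {i}. R i $$ (k, p k))"
        using i by (simp add: prod.remove)
      also have "R i $$ (i, p i) = d (A $$ (i, p i))" using i less by (simp add: R_def)
      also have "(\<Prod>k\<in>{..<n} - {i}. R i $$ (k, p k)) = (\<Prod>k\<in>{..<n} - {i}. A $$ (k, p k))"
        using less by (intro prod.cong) (auto simp: R_def)
      finally show ?thesis .
    qed
    then show "(\<Sum>p\<in>?P. signof p * (d (A $$ (i, p i)) * (\<Prod>k\<in>{..<n} - {i}. A $$ (k, p k)))) = det (R i)"
      unfolding det_def'[OF R] by (simp add: atLeast0LessThan)
  qed
  also have "\<dots> = (\<Sum>i<n. \<Sum>j<n. d (A $$ (i, j)) * cofactor A i j)"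
  proof (intro sum.cong refl)
    fix i assume "i \<in> {..<n}"
    then show "det (R i) = (\<Sum>j<n. d (A $$ (i, j)) * cofactor A i j)"
      using A by (subst det_row_expansion[of i n A "R i"]) (auto simp: R_def)
  qed
  finally show ?thesis .
qed

subsection \<open>Derivations and discriminant ideals\<close>

definition gram :: "('s::ring_1 \<Rightarrow> 'c::comm_ring_1) \<Rightarrow> nat \<Rightarrow> 's list \<Rightarrow> 's list \<Rightarrow> 'c mat" where
  "gram tr n xs ys = mat n n (\<lambda>(i, j). tr (xs ! i * ys ! j))"

lemma gram_carrier [simp]: "gram tr n xs ys \<in> carrier_mat n n"
  by (simp add: gram_def)

lemma trace_det_gram: "trace_det tr n xs ys = det (gram tr n xs ys)"
  by (simp add: trace_det_def gram_def)

lemma trace_det_commute: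
  assumes "\<And>x y. tr (x * y) = tr (y * x)"
  shows "trace_det tr n xs ys = trace_det tr n ys xs"
proof -
  have "transpose_mat (gram tr n xs ys) = gram tr n ys xs"
    by (intro eq_matI) (auto simp: gram_def assms)
  then show ?thesis
    by (metis trace_det_gram det_transpose gram_carrier)
qed

text \<open>Only row \<open>i\<close> of the Gram matrix changes. Using the cofactors of the
  unchanged list shows additivity in \<open>a\<close> and matches the terms of Jacobi's
  formula.\<close>

lemma trace_det_update_left:
  assumes "length xs = n" "i < n"
  shows "trace_det tr n (xs[i := a]) ys = (\<Sum>j<n. tr (a * ys ! j) * cofactor (gram tr n xs ys) i j)"
  unfolding trace_det_gram
  using assms by (subst det_row_expansion[of i n "gram tr n xs ys"]) (auto simp: gram_def)

lemma trace_det_update_right: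
  assumes "length ys = n" "j < n"
  shows "trace_det tr n xs (ys[j := a]) = (\<Sum>i<n. tr (xs ! i * a) * cofactor (gram tr n xs ys) i j)"
  unfolding trace_det_gram
  using assms by (subst det_col_expansion[of j n "gram tr n xs ys"]) (auto simp: gram_def)

text \<open>Replacing an entry of a list may create a repetition. Two equal rows then make the
  determinant vanish, so such lists cause no trouble in \<open>discriminant_ideal\<close>.\<close>

lemma trace_det_not_distinct:
  assumes "length ys = n" "\<not> distinct ys"
  shows "trace_det tr n ys ys = 0"
proof -
  obtain i j where "i < n" "j < n" "i \<noteq> j" "ys ! i = ys ! j"
    using assms by (auto simp: distinct_conv_nth)
  then show ?thesis
    unfolding trace_det_gram
    by (intro det_identical_rows[OF gram_carrier, of i j]) (auto simp: gram_def intro!: eq_vecI)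
qed

text \<open>For a symmetric trace form the Gram determinant is quadratic in the entry at
  \<open>i\<close>, and its polar form is twice the mixed determinant.\<close>

lemma trace_det_polarisation:
  assumes add: "\<And>x y. tr (x + y) = tr x + tr y" and comm: "\<And>x y. tr (x * y) = tr (y * x)"
    and len: "length ys = n" "i < n"
  shows "trace_det tr n (ys[i := z]) ys + trace_det tr n (ys[i := z]) ys =
    trace_det tr n (ys[i := ys ! i + z]) (ys[i := ys ! i + z]) - trace_det tr n ys ys
      - trace_det tr n (ys[i := z]) (ys[i := z])"
proof -
  have left: "trace_det tr n (ys[i := ys ! i + z]) xs = trace_det tr n ys xs + trace_det tr n (ys[i := z]) xs"
    for xs
    using trace_det_update_left[OF len, of tr "ys ! i" xs] len
    by (simp add: trace_det_update_left distrib_right add sum.distrib)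
  then have right: "trace_det tr n xs (ys[i := ys ! i + z]) = trace_det tr n xs ys + trace_det tr n xs (ys[i := z])"
    for xs
    by (metis trace_det_commute[of tr, OF comm])
  have "trace_det tr n ys (ys[i := z]) = trace_det tr n (ys[i := z]) ys"
    by (rule trace_det_commute[of tr, OF comm])
  then show ?thesis
    by (simp add: left right)
qed

text \<open>Jacobi's formula for the Gram matrix. The Leibniz rule splits the derivative of each
  entry in two; the first halves are gathered by rows, the second by columns.\<close>

lemma (in comm_ring_derivation) trace_det:
  assumes D: "\<And>x y. D (x * y) = D x * y + x * D y"
    and add: "\<And>x y. tr (x + y) = tr x + tr y"
    and comm: "\<And>x. d (tr x) = tr (D x)"
    and len: "length xs = n" "length ys = n"
  shows "d (trace_det tr n xs ys) = (\<Sum>i<n. trace_det tr n (xs[i := D (xs ! i)]) ys) +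
    (\<Sum>j<n. trace_det tr n xs (ys[j := D (ys ! j)]))"
proof -
  let ?C = "cofactor (gram tr n xs ys)"
  have "d (trace_det tr n xs ys) =
      (\<Sum>i<n. \<Sum>j<n. (tr (D (xs ! i) * ys ! j) + tr (xs ! i * D (ys ! j))) * ?C i j)"
    unfolding trace_det_gram det[OF gram_carrier] by (simp add: gram_def comm D add)
  also have "\<dots> = (\<Sum>i<n. \<Sum>j<n. tr (D (xs ! i) * ys ! j) * ?C i j) +
      (\<Sum>j<n. \<Sum>i<n. tr (xs ! i * D (ys ! j)) * ?C i j)"
    by (subst sum.swap[of _ "{..<n}" "{..<n}"]) (simp add: distrib_right sum.distrib)
  finally show ?thesis
    by (simp add: trace_det_update_left trace_det_update_right len)
qed

section \<open>Ideals of the type-level ring and their stability under derivations\<close>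

lemma ideal_class_ring_iff:
  fixes I :: "'a::comm_ring_1 set"
  shows "ideal I class_ring \<longleftrightarrow> 0 \<in> I \<and> (\<forall>x\<in>I. \<forall>y\<in>I. x + y \<in> I) \<and> (\<forall>x\<in>I. \<forall>a. a * x \<in> I)"
    (is "_ \<longleftrightarrow> ?R")
proof
  assume "ideal I class_ring"
  then interpret ideal I "class_ring :: 'a ring" .
  show ?R using zero_closed a_closed I_l_closed by auto
next
  assume R: ?R
  show "ideal I class_ring"
  proof (intro idealI class_ring.ring_axioms)
    have "a_inv class_ring x = - x" for x :: 'a
      by (simp only: class_ring_simps)
    then have inv: "m_inv \<lparr>carrier = UNIV, monoid.mult = (+), one = 0\<rparr> x = - x" for x :: 'a
      by (simp add: a_inv_def)
    have "- x \<in> I" if "x \<in> I" for x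
      using R that by (metis mult_minus1)
    then show "subgroup I (add_monoid class_ring)"
      using R by unfold_locales (auto simp: inv)
  qed (use R in \<open>auto simp: mult.commute\<close>)
qed

lemma ideal_genideal_class_ring: "ideal (genideal class_ring (G :: 'a::comm_ring_1 set)) class_ring"
  by (rule ring.genideal_ideal[OF class_ring.ring_axioms]) simp

lemma genideal_class_ring_self: "G \<subseteq> genideal class_ring (G :: 'a::comm_ring_1 set)"
  by (rule ring.genideal_self[OF class_ring.ring_axioms]) simp

lemma ideal_class_ring_add:
  fixes I :: "'a::comm_ring_1 set"
  assumes "ideal I class_ring" "x \<in> I" "y \<in> I"
  shows "x + y \<in> I"
  using assms unfolding ideal_class_ring_iff by blast

lemma ideal_class_ring_mult:
  fixes I :: "'a::comm_ring_1 set"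
  assumes "ideal I class_ring" "x \<in> I"
  shows "a * x \<in> I" "x * a \<in> I"
  using assms unfolding ideal_class_ring_iff by (auto simp: mult.commute)

lemma ideal_class_ring_uminus:
  fixes I :: "'a::comm_ring_1 set"
  assumes "ideal I class_ring" "x \<in> I"
  shows "- x \<in> I"
  using ideal_class_ring_mult(1)[OF assms, of "- 1"] by simp

lemma ideal_class_ring_diff:
  fixes I :: "'a::comm_ring_1 set"
  assumes "ideal I class_ring" "x \<in> I" "y \<in> I"
  shows "x - y \<in> I"
  using ideal_class_ring_add[OF assms(1,2) ideal_class_ring_uminus[OF assms(1,3)]] by simp

lemma ideal_class_ring_sum:
  fixes I :: "'a::comm_ring_1 set"
  assumes "ideal I class_ring" "\<And>k. k \<in> K \<Longrightarrow> f k \<in> I"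
  shows "sum f K \<in> I"
  using assms(2) assms(1)[unfolded ideal_class_ring_iff]
  by (induction K rule: infinite_finite_induct) auto

text \<open>The members of the generated ideal whose derivative is again a member form an ideal, by
  the Leibniz rule. It contains \<open>G\<close>, so minimality makes it everything.\<close>

lemma (in comm_ring_derivation) genideal_stable:
  assumes "\<And>g. g \<in> G \<Longrightarrow> d g \<in> genideal class_ring G" and "x \<in> genideal class_ring G"
  shows "d x \<in> genideal class_ring G"
proof -
  let ?I = "genideal class_ring G"
  have I: "ideal ?I class_ring" by (rule ideal_genideal_class_ring)
  have "ideal {x \<in> ?I. d x \<in> ?I} class_ring"
    using I unfolding ideal_class_ring_iff by (auto simp: add leibniz)
  moreover have "G \<subseteq> {x \<in> ?I. d x \<in> ?I}"
    using assms(1) genideal_class_ring_self[of G] by auto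
  ultimately have "?I \<subseteq> {x \<in> ?I. d x \<in> ?I}"
    by (rule ring.genideal_minimal[OF class_ring.ring_axioms])
  then show ?thesis using assms(2) by auto
qed

text \<open>The generators allow two independent lists, so replacing one entry by its derivative
  gives another generator.\<close>

lemma (in comm_ring_derivation) modified_discriminant_ideal_stable:
  assumes D: "\<And>x y. D (x * y) = D x * y + x * D y"
    and add: "\<And>x y. tr (x + y) = tr x + tr y"
    and comm: "\<And>x. d (tr x) = tr (D x)"
    and x: "x \<in> modified_discriminant_ideal tr n"
  shows "d x \<in> modified_discriminant_ideal tr n"
proof -
  let ?G = "{trace_det tr n xs ys | xs ys. length xs = n \<and> length ys = n}"
  have I: "ideal (genideal class_ring ?G) class_ring"
    by (rule ideal_genideal_class_ring)
  have G: "trace_det tr n xs ys \<in> genideal class_ring ?G" if "length xs = n" "length ys = n" for xs ys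
    using genideal_class_ring_self[of ?G] that by auto
  have "d g \<in> genideal class_ring ?G" if "g \<in> ?G" for g
  proof -
    from that obtain xs ys where g: "g = trace_det tr n xs ys" "length xs = n" "length ys = n"
      by auto
    show ?thesis
      unfolding g(1) trace_det[of D tr, OF D add comm g(2,3)]
      by (intro ideal_class_ring_add[OF I] ideal_class_ring_sum[OF I] G) (simp_all add: g(2,3))
  qed
  then show ?thesis
    using genideal_stable[of ?G x] x by (simp add: modified_discriminant_ideal_def)
qed

text \<open>Differentiating a generator yields determinants with two different lists. Symmetry of
  the trace pairs them up, and polarisation leads back to equal lists.\<close>

lemma (in comm_ring_derivation) discriminant_ideal_stable:
  assumes D: "\<And>x y. D (x * y) = D x * y + x * D y"
    and add: "\<And>x y. tr (x + y) = tr x + tr y"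
    and tr: "\<And>x y. tr (x * y) = tr (y * x)"
    and comm: "\<And>x. d (tr x) = tr (D x)"
    and x: "x \<in> discriminant_ideal tr n"
  shows "d x \<in> discriminant_ideal tr n"
proof -
  let ?G = "{trace_det tr n ys ys | ys. length ys = n \<and> distinct ys}"
  have I: "ideal (genideal class_ring ?G) class_ring"
    by (rule ideal_genideal_class_ring)
  have G: "trace_det tr n ys ys \<in> genideal class_ring ?G" if "length ys = n" for ys
  proof (cases "distinct ys")
    case True
    then show ?thesis using genideal_class_ring_self[of ?G] that by auto
  next
    case False
    then show ?thesis using I that by (simp add: trace_det_not_distinct ideal_class_ring_iff)
  qed
  have "d g \<in> genideal class_ring ?G" if "g \<in> ?G" for g
  proof -
    from that obtain ys where g: "g = trace_det tr n ys ys" "length ys = n" by auto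
    \<comment> \<open>By symmetry, left and right replacements contribute equally, so each mixed
      determinant occurs twice, as polarisation requires.\<close>
    have "d g = (\<Sum>i<n. trace_det tr n (ys[i := D (ys ! i)]) ys + trace_det tr n (ys[i := D (ys ! i)]) ys)"
      unfolding g(1) trace_det[of D tr, OF D add comm g(2) g(2)] sum.distrib
      by (intro arg_cong2[where f = "(+)"] sum.cong refl trace_det_commute[of tr, OF tr])
    also have "\<dots> \<in> genideal class_ring ?G"
      using G g(2) by (intro ideal_class_ring_sum[OF I])
        (simp add: trace_det_polarisation[of tr, OF add tr] ideal_class_ring_diff[OF I])
    finally show ?thesis .
  qed
  then show ?thesis
    using genideal_stable[of ?G x] x by (simp add: discriminant_ideal_def)
qed

subsection \<open>The canonical trace of a free algebra\<close>

text \<open>The restriction of \<open>\<delta>\<close> to \<open>C\<close>, meaningful when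
  \<open>\<delta>\<close> preserves \<open>range \<iota>\<close>. It extends
  \<open>order_bracket\<close> from \<open>\<Delta> z\<close> to arbitrary derivations.\<close>

definition induced_derivation :: "('c \<Rightarrow> 's) \<Rightarrow> ('s \<Rightarrow> 's) \<Rightarrow> 'c \<Rightarrow> 'c" where
  "induced_derivation \<iota> \<delta> w = the_inv \<iota> (\<delta> (\<iota> w))"

lemma order_bracket_eq: "order_bracket \<iota> \<Delta> z = induced_derivation \<iota> (\<Delta> z)"
  by (simp add: fun_eq_iff order_bracket_def induced_derivation_def)

lemma derivation_add: "derivation scale \<delta> \<Longrightarrow> \<delta> (x + y) = \<delta> x + \<delta> y"
  unfolding derivation_def Vector_Spaces.linear_def by (blast dest: module_hom.add)

lemma derivation_mult: "derivation scale \<delta> \<Longrightarrow> \<delta> (x * y) = \<delta> x * y + x * \<delta> y"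
  unfolding derivation_def by blast

lemma derivation_sum: "derivation scale \<delta> \<Longrightarrow> \<delta> (\<Sum>i\<in>I. f i) = (\<Sum>i\<in>I. \<delta> (f i))"
  unfolding derivation_def Vector_Spaces.linear_def by (blast dest: module_hom.sum)

text \<open>Coordinates are indexed by position instead of by basis vector, so that they serve as
  matrix entries.\<close>

definition coord :: "('c::comm_ring_1 \<Rightarrow> 's::ring_1) \<Rightarrow> 's list \<Rightarrow> nat \<Rightarrow> 's \<Rightarrow> 'c" where
  "coord \<iota> ys i x = Modules.module.representation (cscale \<iota>) (set ys) x (ys ! i)"

lemma canonical_trace_coord: "canonical_trace \<iota> ys x = (\<Sum>i<length ys. coord \<iota> ys i (x * ys ! i))"
  by (simp add: canonical_trace_def left_mult_matrix_def coord_def)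

context central_subalgebra
begin

lemma hom_add: "\<iota> (a + b) = \<iota> a + \<iota> b"
  using linear unfolding Vector_Spaces.linear_def by (blast dest: module_hom.add)

lemma cscale_module: "Modules.module (cscale \<iota>)"
  by unfold_locales (simp_all add: hom_add hom_mult hom_one algebra_simps)

lemma iota_induced_derivation:
  assumes "preserves_subalgebra \<iota> \<delta>"
  shows "\<iota> (induced_derivation \<iota> \<delta> w) = \<delta> (\<iota> w)"
  unfolding induced_derivation_def
  using assms by (intro f_the_inv_into_f[OF inj]) (auto simp: preserves_subalgebra_def)

lemma induced_derivation:
  assumes "derivation scaleS \<delta>" "preserves_subalgebra \<iota> \<delta>"
  shows "comm_ring_derivation (induced_derivation \<iota> \<delta>)"
proof
  note iota = iota_induced_derivation[OF assms(2)]
  show "induced_derivation \<iota> \<delta> (a + b) = induced_derivation \<iota> \<delta> a + induced_derivation \<iota> \<delta> b" for a b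
    by (rule injD[OF inj]) (simp add: iota hom_add derivation_add[OF assms(1)])
  show "induced_derivation \<iota> \<delta> (a * b) = induced_derivation \<iota> \<delta> a * b + a * induced_derivation \<iota> \<delta> b" for a b
    by (rule injD[OF inj]) (simp add: iota hom_add hom_mult derivation_mult[OF assms(1)])
qed

context
  fixes ys :: "'s list"
  assumes basis: "module_basis \<iota> ys"
begin

interpretation M: Modules.module "cscale \<iota>"
  by (rule cscale_module)

lemma coord_add: "coord \<iota> ys i (x + y) = coord \<iota> ys i x + coord \<iota> ys i y"
  using basis by (simp add: coord_def module_basis_def M.representation_add)

lemma coord_scale: "coord \<iota> ys i (\<iota> a * x) = a * coord \<iota> ys i x"
  using basis by (simp add: coord_def module_basis_def M.representation_scale)

lemma coord_sum: "coord \<iota> ys i (\<Sum>k\<in>K. f k) = (\<Sum>k\<in>K. coord \<iota> ys i (f k))"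
  using basis by (simp add: coord_def module_basis_def M.representation_sum)

lemma coord_basis: "i < length ys \<Longrightarrow> j < length ys \<Longrightarrow> coord \<iota> ys i (ys ! j) = (if i = j then 1 else 0)"
  using basis by (simp add: coord_def module_basis_def M.representation_basis nth_eq_iff_index_eq)

lemma coord_expansion: "(\<Sum>i<length ys. \<iota> (coord \<iota> ys i x) * ys ! i) = x"
proof -
  have "bij_betw ((!) ys) {..<length ys} (set ys)"
    using basis by (intro bij_betw_nth) (auto simp: module_basis_def)
  then have "(\<Sum>i<length ys. \<iota> (coord \<iota> ys i x) * ys ! i) =
      (\<Sum>y\<in>set ys. \<iota> (M.representation (set ys) x y) * y)"
    unfolding coord_def by (intro sum.reindex_bij_betw)
  also have "\<dots> = x"
    using basis by (intro M.sum_representation_eq) (auto simp: module_basis_def)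
  finally show ?thesis .
qed

text \<open>Applying \<open>\<delta>\<close> to the basis expansion of \<open>x\<close>
  differentiates either the coordinates or the basis vectors; the latter contribute the matrix of
  \<open>\<delta>\<close> on the basis.\<close>

lemma coord_derivation:
  assumes "derivation scaleS \<delta>" "preserves_subalgebra \<iota> \<delta>" "i < length ys"
  shows "coord \<iota> ys i (\<delta> x) = induced_derivation \<iota> \<delta> (coord \<iota> ys i x) +
    (\<Sum>k<length ys. coord \<iota> ys k x * coord \<iota> ys i (\<delta> (ys ! k)))"
proof -
  have "\<delta> x = (\<Sum>k<length ys. \<delta> (\<iota> (coord \<iota> ys k x) * ys ! k))"
    by (subst coord_expansion[of x, symmetric]) (rule derivation_sum[OF assms(1)])
  also have "\<dots> = (\<Sum>k<length ys. \<iota> (induced_derivation \<iota> \<delta> (coord \<iota> ys k x)) * ys ! k +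
      \<iota> (coord \<iota> ys k x) * \<delta> (ys ! k))"
    by (simp add: derivation_mult[OF assms(1)] iota_induced_derivation[OF assms(2)])
  finally have "coord \<iota> ys i (\<delta> x) = (\<Sum>k<length ys.
      induced_derivation \<iota> \<delta> (coord \<iota> ys k x) * coord \<iota> ys i (ys ! k)) +
      (\<Sum>k<length ys. coord \<iota> ys k x * coord \<iota> ys i (\<delta> (ys ! k)))"
    by (simp add: coord_sum coord_add coord_scale sum.distrib)
  then show ?thesis
    using assms(3) by (simp add: coord_basis if_distrib cong: if_cong)
qed

lemma canonical_trace_add: "canonical_trace \<iota> ys (x + y) = canonical_trace \<iota> ys x + canonical_trace \<iota> ys y"
  by (simp add: canonical_trace_coord distrib_right coord_add sum.distrib)

lemma canonical_trace_scale: "canonical_trace \<iota> ys (\<iota> a * x) = a * canonical_trace \<iota> ys x"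
  by (simp add: canonical_trace_coord mult.assoc coord_scale sum_distrib_left)

lemma canonical_trace_sum: "canonical_trace \<iota> ys (\<Sum>k\<in>K. f k) = (\<Sum>k\<in>K. canonical_trace \<iota> ys (f k))"
  by (simp add: canonical_trace_coord sum_distrib_right coord_sum sum.swap[of _ K])

text \<open>Let L be the matrix of left multiplication by \<open>x\<close> and B that of
  \<open>\<delta>\<close> on the basis. Left multiplication by \<open>\<delta> x\<close> is the
  commutator of \<open>\<delta>\<close> with left multiplication by \<open>x\<close>, so its matrix
  is the entrywise derivative of L plus BL - LB, and BL - LB has trace 0.\<close>

lemma canonical_trace_derivation:
  assumes "derivation scaleS \<delta>" "preserves_subalgebra \<iota> \<delta>"
  shows "induced_derivation \<iota> \<delta> (canonical_trace \<iota> ys x) = canonical_trace \<iota> ys (\<delta> x)"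
proof -
  let ?d = "induced_derivation \<iota> \<delta>" and ?c = "coord \<iota> ys" and ?n = "length ys"
  interpret d: comm_ring_derivation ?d by (rule induced_derivation[OF assms])
  \<comment> \<open>The diagonal entries of this identity, found by computing coordinate
    \<open>j\<close> of \<open>\<delta> (x * ys ! j)\<close> in two ways.\<close>
  have "?c j (\<delta> x * ys ! j) = ?d (?c j (x * ys ! j)) +
      (\<Sum>k<?n. ?c k (x * ys ! j) * ?c j (\<delta> (ys ! k))) -
      (\<Sum>k<?n. ?c k (\<delta> (ys ! j)) * ?c j (x * ys ! k))" if "j < ?n" for j
  proof -
    have "x * \<delta> (ys ! j) = (\<Sum>k<?n. \<iota> (?c k (\<delta> (ys ! j))) * (x * ys ! k))"
      by (subst coord_expansion[of "\<delta> (ys ! j)", symmetric])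
        (simp add: sum_distrib_left central mult.assoc)
    then have "?c j (x * \<delta> (ys ! j)) = (\<Sum>k<?n. ?c k (\<delta> (ys ! j)) * ?c j (x * ys ! k))"
      by (simp add: coord_sum coord_scale)
    then show ?thesis
      using coord_derivation[OF assms that, of "x * ys ! j"]
      by (simp add: derivation_mult[OF assms(1)] coord_add algebra_simps)
  qed
  then have "canonical_trace \<iota> ys (\<delta> x) = (\<Sum>j<?n. ?d (?c j (x * ys ! j))) +
      (\<Sum>j<?n. \<Sum>k<?n. ?c k (x * ys ! j) * ?c j (\<delta> (ys ! k))) -
      (\<Sum>j<?n. \<Sum>k<?n. ?c k (\<delta> (ys ! j)) * ?c j (x * ys ! k))"
    by (simp add: canonical_trace_coord sum.distrib sum_subtractf)
  also have "(\<Sum>j<?n. \<Sum>k<?n. ?c k (x * ys ! j) * ?c j (\<delta> (ys ! k))) =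
      (\<Sum>j<?n. \<Sum>k<?n. ?c k (\<delta> (ys ! j)) * ?c j (x * ys ! k))"
    by (subst sum.swap) (simp add: mult.commute)
  finally show ?thesis
    by (simp add: canonical_trace_coord d.sum)
qed

text \<open>If \<open>M\<close> is the Gram matrix and \<open>B\<close> the matrix of \<open>\<delta>\<close> on the basis, then
  \<open>\<delta> M = B\<^sup>T M + M B\<close>, so the logarithmic derivative of \<open>det M\<close> is twice the trace of \<open>B\<close>.\<close>
lemma free_discriminant_derivation:
  assumes "derivation scaleS \<delta>" "preserves_subalgebra \<iota> \<delta>"
  shows "induced_derivation \<iota> \<delta> (free_discriminant \<iota> ys) =
    free_discriminant \<iota> ys * (2 * (\<Sum>i<length ys. coord \<iota> ys i (\<delta> (ys ! i))))"
proof -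
  let ?d = "induced_derivation \<iota> \<delta>" and ?n = "length ys" and ?tr = "canonical_trace \<iota> ys"
  let ?b = "\<lambda>k i. coord \<iota> ys k (\<delta> (ys ! i))"
  let ?M = "gram ?tr ?n ys ys"
  let ?C = "cofactor ?M"
  interpret d: comm_ring_derivation ?d by (rule induced_derivation[OF assms])
  have expand: "\<delta> (ys ! i) = (\<Sum>k<?n. \<iota> (?b k i) * ys ! k)" for i
    by (rule coord_expansion[symmetric])
  have M: "?M $$ (i, j) = ?tr (ys ! i * ys ! j)" if "i < ?n" "j < ?n" for i j
    using that by (simp add: gram_def)
  have dM: "?d (?M $$ (i, j)) = (\<Sum>k<?n. ?b k i * ?M $$ (k, j)) + (\<Sum>k<?n. ?b k j * ?M $$ (i, k))"
    if "i < ?n" "j < ?n" for i j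
  proof -
    have "?tr (\<delta> (ys ! i) * ys ! j) = (\<Sum>k<?n. ?b k i * ?tr (ys ! k * ys ! j))"
      by (subst expand) (simp add: sum_distrib_right mult.assoc canonical_trace_sum canonical_trace_scale)
    moreover have "ys ! i * \<delta> (ys ! j) = (\<Sum>k<?n. \<iota> (?b k j) * (ys ! i * ys ! k))"
      by (subst expand) (simp add: sum_distrib_left central mult.assoc)
    then have "?tr (ys ! i * \<delta> (ys ! j)) = (\<Sum>k<?n. ?b k j * ?tr (ys ! i * ys ! k))"
      by (simp add: canonical_trace_sum canonical_trace_scale)
    ultimately show ?thesis
      using that
      by (simp add: M canonical_trace_derivation[OF assms] derivation_mult[OF assms(1)] canonical_trace_add)
  qed
  have "?d (free_discriminant \<iota> ys) =
      (\<Sum>i<?n. \<Sum>j<?n. ((\<Sum>k<?n. ?b k i * ?M $$ (k, j)) + (\<Sum>k<?n. ?b k j * ?M $$ (i, k))) * ?C i j)"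
    unfolding free_discriminant_def trace_det_gram d.det[OF gram_carrier]
    by (intro sum.cong refl arg_cong2[where f = "(*)"] dM) auto
  also have "\<dots> = (\<Sum>i<?n. \<Sum>j<?n. \<Sum>k<?n. ?b k i * (?M $$ (k, j) * ?C i j)) +
      (\<Sum>i<?n. \<Sum>j<?n. \<Sum>k<?n. ?b k j * (?M $$ (i, k) * ?C i j))"
    by (simp add: distrib_right sum.distrib sum_distrib_right mult.assoc)
  \<comment> \<open>The sum over \<open>j\<close> goes innermost: row \<open>k\<close> against the
    cofactors of row \<open>i\<close> gives 0 unless \<open>k = i\<close>, which leaves the trace of
    the matrix of \<open>\<delta>\<close>.\<close>
  also have "(\<Sum>i<?n. \<Sum>j<?n. \<Sum>k<?n. ?b k i * (?M $$ (k, j) * ?C i j)) =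
      (\<Sum>i<?n. \<Sum>k<?n. ?b k i * (\<Sum>j<?n. ?M $$ (k, j) * ?C i j))"
    unfolding sum_distrib_left by (intro sum.cong refl sum.swap)
  also have "\<dots> = (\<Sum>i<?n. ?b i i * det ?M)"
    by (simp add: sum_row_cofactor if_distrib cong: if_cong)
  also have "(\<Sum>i<?n. \<Sum>j<?n. \<Sum>k<?n. ?b k j * (?M $$ (i, k) * ?C i j)) =
      (\<Sum>j<?n. \<Sum>k<?n. ?b k j * (\<Sum>i<?n. ?M $$ (i, k) * ?C i j))"
    unfolding sum_distrib_left by (subst sum.swap) (intro sum.cong refl sum.swap)
  also have "\<dots> = (\<Sum>i<?n. ?b i i * det ?M)"
    by (simp add: sum_col_cofactor if_distrib cong: if_cong)
  finally show ?thesis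
    by (simp add: free_discriminant_def trace_det_gram sum_distrib_left sum_distrib_right algebra_simps)
qed

end

end

subsection \<open>Poisson prime ideals and Poisson prime factorizations\<close>

lemma radical_ideal_class_ring:
  fixes I :: "'a::comm_ring_1 set"
  assumes I: "ideal I class_ring"
  shows "ideal {a. \<exists>n. a ^ n \<in> I} class_ring"
  unfolding ideal_class_ring_iff
proof (intro conjI ballI allI)
  show "0 \<in> {a. \<exists>n. a ^ n \<in> I}"
    using I by (auto simp: ideal_class_ring_iff intro: exI[of _ 1])
next
  fix x y assume "x \<in> {a. \<exists>n. a ^ n \<in> I}" "y \<in> {a. \<exists>n. a ^ n \<in> I}"
  then obtain n m where n: "x ^ n \<in> I" and m: "y ^ m \<in> I" by auto
  \<comment> \<open>Each binomial term has at least \<open>n\<close> factors \<open>x\<close> or at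
    least \<open>m\<close> factors \<open>y\<close>.\<close>
  have "of_nat (n + m choose k) * x ^ k * y ^ (n + m - k) \<in> I" for k
  proof (cases "n \<le> k")
    case True
    then have "x ^ k = x ^ (k - n) * x ^ n"
      by (simp flip: power_add)
    then have "of_nat (n + m choose k) * x ^ k * y ^ (n + m - k) =
        (of_nat (n + m choose k) * x ^ (k - n) * y ^ (n + m - k)) * x ^ n"
      by (simp add: mult_ac)
    then show ?thesis using ideal_class_ring_mult[OF I n] by metis
  next
    case False
    then have "n + m - k = (n - k) + m" by simp
    then have "of_nat (n + m choose k) * x ^ k * y ^ (n + m - k) =
        (of_nat (n + m choose k) * x ^ k * y ^ (n - k)) * y ^ m"
      by (simp add: mult_ac power_add)
    then show ?thesis using ideal_class_ring_mult[OF I m] by metis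
  qed
  then have "(x + y) ^ (n + m) \<in> I"
    unfolding binomial_ring by (intro ideal_class_ring_sum[OF I])
  then show "x + y \<in> {a. \<exists>n. a ^ n \<in> I}" by blast
next
  fix x a assume "x \<in> {a. \<exists>n. a ^ n \<in> I}"
  then show "a * x \<in> {a. \<exists>n. a ^ n \<in> I}"
    using ideal_class_ring_mult(1)[OF I] by (auto simp: power_mult_distrib)
qed

lemma (in comm_ring_derivation) power_times_base: "d (b ^ j) * b = of_nat j * b ^ j * d b"
  by (induction j) (simp_all add: leibniz algebra_simps)

text \<open>Makes the radical of a \<open>d\<close>-stable ideal \<open>d\<close>-stable. Starting
  from \<open>a ^ n\<close>, one factor \<open>a\<close> at a time is traded for two factors
  \<open>d a\<close>.\<close>

lemma (in comm_ring_derivation) power_derivation_mem_ideal: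
  assumes I: "ideal I class_ring" and stable: "\<And>y. y \<in> I \<Longrightarrow> d y \<in> I"
    and unit: "\<And>n. of_nat (Suc n) dvd (1 :: 'a)"
    and "a ^ n \<in> I"
  shows "d a ^ (2 * n) \<in> I"
proof -
  have "a ^ m * d a ^ (2 * k) \<in> I" if "m + k = n" for m k
    using that
  proof (induction k arbitrary: m)
    case 0
    then show ?case using assms(4) by simp
  next
    case (Suc k)
    then have IH: "a ^ Suc m * d a ^ (2 * k) \<in> I" using Suc.IH[of "Suc m"] by simp
    \<comment> \<open>Differentiating the element given by the induction hypothesis uses up one
      \<open>a\<close>. The extra factor \<open>d a\<close> turns the other summand into a multiple
      of that same element.\<close>
    have "d (a ^ Suc m * d a ^ (2 * k)) * d a =
        d (a ^ Suc m) * (d a ^ (2 * k) * d a) + a ^ Suc m * (d (d a ^ (2 * k)) * d a)"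
      by (simp only: leibniz distrib_right mult.assoc)
    also have "\<dots> = of_nat (Suc m) * (a ^ m * d a ^ (2 * Suc k)) +
        (of_nat (2 * k) * d (d a)) * (a ^ Suc m * d a ^ (2 * k))"
      unfolding derivation_power_Suc power_times_base
      by (simp only: mult_Suc mult_Suc_right add_2_eq_Suc power_Suc mult_ac)
    finally have "d (a ^ Suc m * d a ^ (2 * k)) * d a =
        of_nat (Suc m) * (a ^ m * d a ^ (2 * Suc k)) +
        (of_nat (2 * k) * d (d a)) * (a ^ Suc m * d a ^ (2 * k))" .
    then have "of_nat (Suc m) * (a ^ m * d a ^ (2 * Suc k)) \<in> I"
      using ideal_class_ring_diff[OF I ideal_class_ring_mult(2)[OF I stable[OF IH]] ideal_class_ring_mult(1)[OF I IH]]
      by (metis add_diff_cancel_right')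
    moreover obtain v where "1 = of_nat (Suc m) * (v :: 'a)"
      using unit[of m] by (elim dvdE)
    ultimately show ?case
      by (metis ideal_class_ring_mult(1)[OF I] mult.assoc mult.commute mult_1)
  qed
  from this[of 0 n] show ?thesis by simp
qed

section \<open>Poisson ideals and Poisson normal elements in characteristic 0\<close>

locale poisson_algebra_char_0 = poisson_algebra scale br
  for scale :: "'k::field_char_0 \<Rightarrow> 'a::comm_ring_1 \<Rightarrow> 'a" and br
begin

sublocale br: comm_ring_derivation "br a" for a
  using leibniz[of a] by unfold_locales (simp_all add: derivation_add derivation_mult)

lemma br_antisym: "br a b = - br b a"
proof -
  have add_left: "br (x + y) z = br x z + br y z" for x y z
    using linear_left unfolding Vector_Spaces.linear_def by (blast dest: module_hom.add)
  show ?thesis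
    using alternating[of "a + b"] unfolding add_left br.add
    by (simp add: alternating eq_neg_iff_add_eq_0 add.commute)
qed

text \<open>Antisymmetry moves \<open>a\<close> into the second slot, where \<open>br x\<close> acts
  as a derivation.\<close>

lemma poisson_normal_iff: "poisson_normal br a \<longleftrightarrow> (\<forall>x. a dvd br x a)"
  unfolding poisson_normal_def dvd_def by (subst br_antisym) (metis minus_minus mult_minus_right)

lemma poisson_ideal_iff: "poisson_ideal br I \<longleftrightarrow> ideal I class_ring \<and> (\<forall>a. \<forall>x\<in>I. br a x \<in> I)"
  unfolding poisson_ideal_def by (metis br_antisym ideal_class_ring_uminus)

text \<open>The inverse comes from the base field of characteristic 0.\<close>

lemma of_nat_Suc_dvd_one: "of_nat (Suc n) dvd (1 :: 'a)"
proof
  have "of_nat k = scale (of_nat k) (1 :: 'a)" for k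
    by (induction k) (simp_all add: scale_left_distrib)
  then have "of_nat (Suc n) * scale (inverse (of_nat (Suc n))) (1 :: 'a) =
      scale (inverse (of_nat (Suc n)) * of_nat (Suc n)) 1"
    by (metis mult_1_right scale_mult_right scale_scale)
  also have "\<dots> = 1"
    by (subst left_inverse) (simp_all del: of_nat_Suc)
  finally show "1 = of_nat (Suc n) * scale (inverse (of_nat (Suc n))) (1 :: 'a)" ..
qed

lemma dvd_of_nat_Suc_mult_iff: "a dvd of_nat (Suc n) * b \<longleftrightarrow> a dvd (b :: 'a)"
proof -
  obtain v where v: "1 = of_nat (Suc n) * (v :: 'a)"
    using of_nat_Suc_dvd_one[of n] by (elim dvdE)
  have "b = of_nat (Suc n) * b * v"
    using arg_cong[OF v, of "(*) b"] unfolding mult_1_right by (simp only: mult_ac)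
  then show ?thesis by (metis dvd_mult dvd_mult2)
qed

lemma poisson_ideal_radical:
  assumes "poisson_ideal br I"
  shows "poisson_ideal br {a. \<exists>n. a ^ n \<in> I}"
  using assms br.power_derivation_mem_ideal[OF _ _ of_nat_Suc_dvd_one, of I] radical_ideal_class_ring[of I]
  unfolding poisson_ideal_iff by blast

text \<open>The square of \<open>a * br x c\<close> is a combination of \<open>br x (a * c)\<close>
  and \<open>a * c\<close>, both in \<open>I\<close>, and \<open>I\<close> is radical.\<close>

lemma poisson_ideal_colon:
  assumes I: "poisson_ideal br I" and radical: "\<And>a n. a ^ n \<in> I \<Longrightarrow> a \<in> I"
  shows "poisson_ideal br {c. a * c \<in> I}"
  unfolding poisson_ideal_iff
proof (intro conjI allI ballI)
  have ideal: "ideal I class_ring" using I by (simp add: poisson_ideal_iff)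
  show "ideal {c. a * c \<in> I} class_ring"
    using ideal unfolding ideal_class_ring_iff by (auto simp: distrib_left mult.left_commute)
  fix x c assume "c \<in> {c. a * c \<in> I}"
  then have c: "a * c \<in> I" by simp
  then have "br x (a * c) \<in> I" using I by (simp add: poisson_ideal_iff)
  then have "(br x (a * c)) * (a * br x c) - (br x a * br x c) * (a * c) \<in> I"
    by (intro ideal_class_ring_diff[OF ideal] ideal_class_ring_mult(2)[OF ideal]
        ideal_class_ring_mult(1)[OF ideal c])
  also have "(br x (a * c)) * (a * br x c) - (br x a * br x c) * (a * c) = (a * br x c) ^ 2"
    by (simp add: br.leibniz power2_eq_square algebra_simps)
  finally show "br x c \<in> {c. a * c \<in> I}" using radical by blast
qed

text \<open>Zorn's lemma: the union of a nonempty chain of Poisson ideals is a Poisson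
  ideal.\<close>

lemma exists_maximal_poisson_ideal:
  assumes I: "poisson_ideal br I" "I \<inter> M = {}"
  obtains Q where "poisson_ideal br Q" "I \<subseteq> Q" "Q \<inter> M = {}"
    "\<And>J. poisson_ideal br J \<Longrightarrow> Q \<subseteq> J \<Longrightarrow> J \<inter> M = {} \<Longrightarrow> J = Q"
proof -
  define S where "S = {J. poisson_ideal br J \<and> I \<subseteq> J \<and> J \<inter> M = {}}"
  have "\<exists>Q\<in>S. \<forall>J\<in>S. Q \<subseteq> J \<longrightarrow> J = Q"
  proof (rule subset_Zorn_nonempty)
    show "S \<noteq> {}" using I by (auto simp: S_def)
    fix C assume C: "C \<noteq> {}" "subset.chain S C"
    then have CS: "C \<subseteq> S" and total: "\<And>J K. J \<in> C \<Longrightarrow> K \<in> C \<Longrightarrow> J \<subseteq> K \<or> K \<subseteq> J"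
      by (auto simp: subset_chain_def)
    have "subset.chain {J. ideal J class_ring} C"
      using CS total by (auto simp: subset_chain_def S_def poisson_ideal_def)
    then have "ideal (\<Union>C) class_ring"
      using ring.chain_Union_is_ideal[OF class_ring.ring_axioms, of C] C(1) by simp
    then have "poisson_ideal br (\<Union>C)"
      using CS unfolding poisson_ideal_iff S_def by blast
    then show "\<Union>C \<in> S"
      using CS C(1) by (auto simp: S_def)
  qed
  then obtain Q where Q: "Q \<in> S" "\<And>J. J \<in> S \<Longrightarrow> Q \<subseteq> J \<Longrightarrow> J = Q"
    by blast
  show thesis
    using Q by (intro that[of Q]) (auto simp: S_def)
qed

text \<open>Poisson analogue of Krull's theorem on prime ideals avoiding a multiplicative
  set.\<close>

lemma exists_poisson_primeideal:
  assumes one: "1 \<in> M" and mult: "\<And>x y. x \<in> M \<Longrightarrow> y \<in> M \<Longrightarrow> x * y \<in> M"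
    and I: "poisson_ideal br I" "I \<inter> M = {}"
  shows "\<exists>P. primeideal P class_ring \<and> poisson_ideal br P \<and> I \<subseteq> P \<and> P \<inter> M = {}"
proof -
  obtain Q where Q: "poisson_ideal br Q" "I \<subseteq> Q" "Q \<inter> M = {}"
    and max: "\<And>J. poisson_ideal br J \<Longrightarrow> Q \<subseteq> J \<Longrightarrow> J \<inter> M = {} \<Longrightarrow> J = Q"
    using exists_maximal_poisson_ideal[OF I] by blast
  have ideal: "ideal Q class_ring" using Q(1) by (simp add: poisson_ideal_def)
  have pow: "a ^ n \<in> M" if "a \<in> M" for a n
    using that by (induction n) (auto simp: one mult)
  have "{a. \<exists>n. a ^ n \<in> Q} = Q"
  proof (rule max[OF poisson_ideal_radical[OF Q(1)]])
    show "Q \<subseteq> {a. \<exists>n. a ^ n \<in> Q}" by (metis (mono_tags) mem_Collect_eq power_one_right subsetI)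
    show "{a. \<exists>n. a ^ n \<in> Q} \<inter> M = {}" using Q(3) pow by blast
  qed
  then have radical: "a \<in> Q" if "a ^ n \<in> Q" for a n
    using that by blast
  \<comment> \<open>The colon ideal of \<open>a\<close> contains \<open>Q\<close> and also
    \<open>b\<close>, so it is strictly larger and meets \<open>M\<close> by maximality.\<close>
  have meets: "\<exists>m\<in>M. a * m \<in> Q" if "a * b \<in> Q" "b \<notin> Q" for a b
  proof (rule ccontr)
    assume "\<not> (\<exists>m\<in>M. a * m \<in> Q)"
    then have "{c. a * c \<in> Q} = Q"
      using ideal_class_ring_mult(1)[OF ideal]
      by (intro max[OF poisson_ideal_colon[OF Q(1) radical]]) auto
    then show False using that by blast
  qed
  have "primeideal Q class_ring"
  proof (rule primeidealI[OF ideal class_cring.cring_axioms])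
    show "carrier class_ring \<noteq> Q" using Q(3) one by auto
    fix a b assume "a \<otimes>\<^bsub>class_ring\<^esub> b \<in> Q"
    then have ab: "a * b \<in> Q" by simp
    show "a \<in> Q \<or> b \<in> Q"
    proof (rule ccontr)
      assume "\<not> (a \<in> Q \<or> b \<in> Q)"
      \<comment> \<open>Two exchanges: \<open>b\<close> is traded for \<open>m\<close> in
        \<open>M\<close>, then \<open>a\<close> for \<open>m'\<close> in \<open>M\<close>, which
        puts \<open>m * m'\<close> into both \<open>Q\<close> and \<open>M\<close>.\<close>
      then obtain m where m: "m \<in> M" "m * a \<in> Q" "a \<notin> Q"
        using meets[OF ab] by (auto simp: mult.commute)
      then obtain m' where "m' \<in> M" "m * m' \<in> Q"
        using meets by blast
      then show False using Q(3) mult[OF m(1)] by blast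
    qed
  qed
  then show ?thesis using Q by blast
qed

lemma poisson_ideal_principal:
  assumes "poisson_normal br a"
  shows "poisson_ideal br {x. a dvd x}"
  unfolding poisson_ideal_iff
proof (intro conjI allI ballI)
  show "ideal {x. a dvd x} class_ring"
    by (simp add: ideal_class_ring_iff)
  fix y x assume "x \<in> {x. a dvd x}"
  then obtain c where "x = a * c" by auto
  then show "br y x \<in> {x. a dvd x}"
    using assms by (simp add: poisson_normal_iff br.leibniz)
qed

end

section \<open>Factorization in noetherian Poisson unique factorization domains\<close>

lemma domain_class_ring_cancel:
  fixes a :: "'a::comm_ring_1"
  assumes "domain (class_ring :: 'a ring)" "a \<noteq> 0" "a * b = a * c"
  shows "b = c"
proof -
  have "a * (b - c) = 0" using assms(3) by (simp add: right_diff_distrib)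
  then show ?thesis using domain.integral[OF assms(1), of a "b - c"] assms(2) by simp
qed

context poisson_algebra_char_0
begin

lemma noetherian_poisson_ufd_factorization:
  assumes ufd: "noetherian_poisson_ufd br" and a: "poisson_normal br a" "a \<noteq> 0"
  shows "\<exists>u ps. u dvd 1 \<and> (\<forall>p\<in>set ps. poisson_prime br p) \<and> a = u * prod_list ps"
proof (rule ccontr)
  \<comment> \<open>Unit factors are included so that divisors of elements of \<open>M\<close> stay
    in \<open>M\<close>.\<close>
  define M where "M = {u * prod_list ps | u ps. u dvd 1 \<and> (\<forall>p\<in>set ps. poisson_prime br p)}"
  assume "\<not> ?thesis"
  then have aM: "a \<notin> M" by (auto simp: M_def)
  have dom: "domain (class_ring :: 'a ring)"
    using ufd by (simp add: noetherian_poisson_ufd_def noetherian_domain_def)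
  have MI: "u * prod_list ps \<in> M" if "u dvd 1" "\<forall>p\<in>set ps. poisson_prime br p" for u ps
    using that by (auto simp: M_def)
  have one: "1 \<in> M" using MI[of 1 "[]"] by simp
  have mult: "x * y \<in> M" if xy: "x \<in> M" "y \<in> M" for x y
  proof -
    obtain u ps where x: "x = u * prod_list ps" "u dvd 1" "\<forall>p\<in>set ps. poisson_prime br p"
      using xy(1) unfolding M_def by auto
    obtain v qs where y: "y = v * prod_list qs" "v dvd 1" "\<forall>p\<in>set qs. poisson_prime br p"
      using xy(2) unfolding M_def by auto
    have "\<forall>p\<in>set (ps @ qs). poisson_prime br p"
      using x(3) y(3) by auto
    then show ?thesis
      using x(1,2) y(1,2) MI[of "u * v" "ps @ qs"] mult_dvd_mono[of u 1 v 1] by (simp add: mult_ac)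
  qed
  \<comment> \<open>Induction on the number of primes: each one divides \<open>b\<close> or
    \<open>c\<close> and can be cancelled there.\<close>
  have saturated: "b \<in> M" if "b * c = u * prod_list ps" "u dvd 1" "\<forall>p\<in>set ps. poisson_prime br p" for b c u ps
    using that
  proof (induction ps arbitrary: b c)
    case Nil
    then show ?case using MI[of b "[]"] dvd_trans[of b u 1] by auto
  next
    case (Cons p ps)
    then have p: "poisson_prime br p" by simp
    then have prime: "prime_elem p" by (simp add: poisson_prime_def)
    then have p0: "p \<noteq> 0" by (rule prime_elem_not_zeroI)
    have eq: "b * c = p * (u * prod_list ps)" using Cons.prems(1) by (simp add: mult_ac)
    then have "p dvd b \<or> p dvd c"
      using prime by (metis dvd_triv_left prime_elem_dvd_mult_iff)
    then show ?case
    proof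
      assume "p dvd b"
      then obtain b' where b': "b = p * b'" ..
      then have "p * (b' * c) = p * (u * prod_list ps)"
        using eq by (simp add: mult.assoc)
      then have "b' * c = u * prod_list ps"
        by (rule domain_class_ring_cancel[OF dom p0])
      then have "b' \<in> M" using Cons by simp
      moreover have "p \<in> M" using MI[of 1 "[p]"] p by simp
      ultimately show ?thesis using mult b' by simp
    next
      assume "p dvd c"
      then obtain c' where c': "c = p * c'" ..
      then have "p * (b * c') = p * (u * prod_list ps)"
        using eq by (simp add: mult.left_commute)
      then have "b * c' = u * prod_list ps"
        by (rule domain_class_ring_cancel[OF dom p0])
      then show ?thesis using Cons by simp
    qed
  qed
  have disjoint: "{x. a dvd x} \<inter> M = {}"
  proof (rule equals0I)
    fix x assume "x \<in> {x. a dvd x} \<inter> M"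
    then obtain c u ps where "x = a * c" "x = u * prod_list ps" "u dvd 1"
      "\<forall>p\<in>set ps. poisson_prime br p"
      unfolding M_def by blast
    then show False using saturated[of a c u ps] aM by simp
  qed
  have "\<exists>P. primeideal P class_ring \<and> poisson_ideal br P \<and> {x. a dvd x} \<subseteq> P \<and> P \<inter> M = {}"
    by (rule exists_poisson_primeideal[OF one _ poisson_ideal_principal[OF a(1)] disjoint])
      (rule mult)
  then obtain P where P: "primeideal P class_ring" "poisson_ideal br P" "{x. a dvd x} \<subseteq> P" "P \<inter> M = {}"
    by blast
  have "a \<in> P" using P(3) by auto
  then have "P \<noteq> {0}" using a(2) by blast
  \<comment> \<open>This prime lies in \<open>P\<close> and, as a product with one factor, in
    \<open>M\<close>.\<close>
  with P obtain p where "p \<in> P" "poisson_prime br p"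
    using ufd unfolding noetherian_poisson_ufd_def by blast
  then show False using MI[of 1 "[p]"] P(4) by auto
qed

end

section \<open>Factorization in factorial domains\<close>

lemma divides_class_ring_iff: "a divides\<^bsub>class_ring\<^esub> b \<longleftrightarrow> a dvd (b :: 'a::comm_ring_1)"
  by (auto simp: factor_def dvd_def)

lemma Units_class_ring_iff: "a \<in> Units class_ring \<longleftrightarrow> a dvd (1 :: 'a::comm_ring_1)"
  using cring.divides_one[OF class_cring.cring_axioms, of a] by (simp add: divides_class_ring_iff)

lemma foldr_times_eq_prod_list: "foldr (*) xs (1 :: 'a::comm_ring_1) = prod_list xs"
  by (induction xs) simp_all

lemma factorial_domain_class_ring_prime_factorization:
  fixes a :: "'a::comm_ring_1"
  assumes "factorial_domain (class_ring :: 'a ring)" "a \<noteq> 0"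
  obtains u ps where "u dvd 1" "\<forall>p\<in>set ps. prime_elem p" "a = u * prod_list ps"
proof -
  let ?R = "class_ring :: 'a ring"
  interpret F: factorial_domain ?R by (rule assms(1))
  show thesis
  proof (cases "a dvd 1")
    case True
    then show ?thesis using that[of a "[]"] by simp
  next
    case False
    \<comment> \<open>Irreducible factors exist for nonunits, in the monoid of nonzero elements; a
      unit is covered above by the empty list.\<close>
    then obtain ps where ps: "set ps \<subseteq> carrier (mult_of ?R)" "factors (mult_of ?R) ps a"
      using F.factors_exist[of a] assms(2)
      by (auto simp: Units_class_ring_iff)
    have "prime_elem p" if p: "p \<in> set ps" for p
    proof -
      have p0: "p \<noteq> 0" using p ps(1) by auto
      moreover have "Divisibility.prime (mult_of ?R) p"
        using ps p by (intro F.irreducible_prime) (auto simp: factors_def)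
      then have "Divisibility.prime ?R p"
        using F.prime_eq_prime_mult[of p] by simp
      ultimately show ?thesis
        by (simp add: prime_elem_def Divisibility.prime_def divides_class_ring_iff Units_class_ring_iff)
    qed
    moreover have "a = prod_list ps"
      using ps(2) by (simp add: factors_def foldr_times_eq_prod_list)
    ultimately show ?thesis using that[of 1 ps] by simp
  qed
qed

text \<open>Each prime \<open>r\<close> of the list either is not divisible by \<open>q\<close> and
  joins \<open>e\<close>, or is associated to \<open>q\<close> and raises the exponent.\<close>

lemma prime_elem_power_part:
  fixes q :: "'a::comm_ring_1"
  assumes dom: "domain (class_ring :: 'a ring)" and q: "prime_elem q"
    and "u dvd 1" "\<forall>p\<in>set ps. prime_elem p"
  shows "\<exists>k e. u * prod_list ps = q ^ k * e \<and> \<not> q dvd e"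
  using assms(4)
proof (induction ps)
  case Nil
  have "\<not> q dvd u" using q assms(3) by (meson dvd_trans prime_elem_not_unit)
  then show ?case by (intro exI[of _ 0] exI[of _ u]) simp
next
  case (Cons r ps)
  then obtain k e where e: "u * prod_list ps = q ^ k * e" "\<not> q dvd e" by auto
  have r: "prime_elem r" using Cons.prems by simp
  show ?case
  proof (cases "q dvd r")
    case False
    then have "\<not> q dvd r * e" using e(2) q by (simp add: prime_elem_dvd_mult_iff)
    moreover have "u * prod_list (r # ps) = q ^ k * (r * e)"
      using e(1) by (simp add: mult_ac)
    ultimately show ?thesis by blast
  next
    case True
    then obtain v where v: "r = q * v" ..
    \<comment> \<open>If \<open>r\<close> divided \<open>v\<close>, then \<open>q\<close> would be a
      unit. So the prime \<open>r = q * v\<close> divides \<open>q\<close>, and \<open>v\<close> is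
      a unit.\<close>
    have "\<not> r dvd v"
    proof
      assume "r dvd v"
      then obtain w where "v = r * w" ..
      then have "r * 1 = r * (q * w)" using v by (simp add: mult_ac)
      then have "1 = q * w"
        using domain_class_ring_cancel[OF dom] prime_elem_not_zeroI[OF r] by blast
      then show False using q by (metis dvd_triv_left prime_elem_not_unit)
    qed
    then have "r dvd q" using r v by (metis dvd_refl prime_elem_dvd_mult_iff)
    then obtain w where "q = r * w" ..
    then have "q * 1 = q * (v * w)" using v by (simp add: mult_ac)
    then have "1 = v * w"
      using domain_class_ring_cancel[OF dom] prime_elem_not_zeroI[OF q] by blast
    then have "\<not> q dvd v" using q by (metis dvd_trans dvd_triv_left prime_elem_not_unit)
    then have "\<not> q dvd v * e" using e(2) q by (simp add: prime_elem_dvd_mult_iff)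
    moreover have "u * prod_list (r # ps) = q ^ Suc k * (v * e)"
    proof -
      have "u * prod_list (r # ps) = r * (u * prod_list ps)" by (simp add: mult_ac)
      also have "\<dots> = q ^ Suc k * (v * e)" unfolding e(1) v by (simp add: mult_ac)
      finally show ?thesis .
    qed
    ultimately show ?thesis by blast
  qed
qed

context poisson_algebra_char_0
begin

text \<open>With \<open>a = q\<^sup>k e\<close> and \<open>q\<close> not dividing \<open>e\<close>, comparing \<open>q\<^sup>k\<close>-parts in
  \<open>a | {x, a} = k q\<^sup>k\<^sup>-\<^sup>1 e {x, q} + q\<^sup>k {x, e}\<close> gives \<open>q | k e {x, q}\<close>.\<close>
lemma prime_divisor_poisson_normal:
  assumes dom: "domain (class_ring :: 'a ring)" and a: "poisson_normal br a"
    and q: "prime_elem q" "q dvd a" and k: "a = q ^ k * e" "\<not> q dvd e"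
  shows "poisson_normal br q"
  unfolding poisson_normal_iff
proof
  fix x
  \<comment> \<open>The exponent is positive because \<open>q\<close> divides \<open>a\<close> but
    not \<open>e\<close>.\<close>
  obtain j where j: "k = Suc j" using q(2) k by (cases k) auto
  have "a dvd br x a" using a by (simp add: poisson_normal_iff)
  then obtain y where y: "br x a = a * y" ..
  have "br x (q ^ Suc j) = of_nat (Suc j) * q ^ j * br x q"
    by (rule br.derivation_power_Suc)
  then have "q ^ j * (of_nat (Suc j) * (e * br x q) + q * br x e) = br x a"
    unfolding k(1) j br.leibniz by (simp add: algebra_simps del: of_nat_Suc)
  also have "\<dots> = q ^ j * (q * (e * y))"
    unfolding y unfolding k(1) j by (simp add: mult_ac)
  finally have eq: "q ^ j * (of_nat (Suc j) * (e * br x q) + q * br x e) = q ^ j * (q * (e * y))" .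
  have "q ^ n \<noteq> 0" for n
  proof (induction n)
    case (Suc n)
    then show ?case using domain_class_ring_cancel[OF dom prime_elem_not_zeroI[OF q(1)], of "q ^ n" 0] by auto
  qed simp
  then have "of_nat (Suc j) * (e * br x q) + q * br x e = q * (e * y)"
    using domain_class_ring_cancel[OF dom _ eq] by blast
  then have "of_nat (Suc j) * (e * br x q) = q * (e * y - br x e)"
    by (simp add: right_diff_distrib eq_diff_eq)
  then have "q dvd of_nat (Suc j) * (e * br x q)"
    by (metis dvd_triv_left)
  \<comment> \<open>The integer \<open>Suc j\<close> is a unit and the prime \<open>q\<close> does
    not divide \<open>e\<close>, so \<open>q\<close> divides the remaining factor.\<close>
  then show "q dvd br x q"
    using q(1) k(2) unfolding dvd_of_nat_Suc_mult_iff by (simp add: prime_elem_dvd_mult_iff)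
qed

lemma factorial_domain_factorization:
  assumes ufd: "factorial_domain (class_ring :: 'a ring)" and a: "poisson_normal br a" "a \<noteq> 0"
  shows "\<exists>u ps. u dvd 1 \<and> (\<forall>p\<in>set ps. poisson_prime br p) \<and> a = u * prod_list ps"
proof -
  have dom: "domain (class_ring :: 'a ring)" using ufd by (simp add: factorial_domain_def)
  obtain u ps where ps: "u dvd 1" "\<forall>p\<in>set ps. prime_elem p" "a = u * prod_list ps"
    using factorial_domain_class_ring_prime_factorization[OF ufd a(2)] .
  have "poisson_prime br p" if p: "p \<in> set ps" for p
  proof -
    have prime: "prime_elem p" using ps p by blast
    then obtain k e where "a = p ^ k * e" "\<not> p dvd e"
      using prime_elem_power_part[OF dom prime ps(1,2)] ps(3) by blast
    moreover have "p dvd a" using split_list[OF p] ps(3) by auto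
    ultimately show ?thesis
      using prime_divisor_poisson_normal[OF dom a(1) prime] prime by (simp add: poisson_prime_def)
  qed
  then show ?thesis using ps by blast
qed

end

section \<open>Application to Poisson orders\<close>

lemma trace_map_add: "trace_map \<iota> tr \<Longrightarrow> tr (x + y) = tr x + tr y"
  unfolding trace_map_def by (blast dest: module_hom.add)

lemma (in central_subalgebra) induced_derivation_trace:
  assumes "preserves_subalgebra \<iota> \<delta>" "trace_commutes \<iota> tr \<delta>"
  shows "induced_derivation \<iota> \<delta> (tr x) = tr (\<delta> x)"
  by (rule injD[OF inj])
    (use assms in \<open>simp add: iota_induced_derivation trace_commutes_def\<close>)

theorem theorem3p10:
  fixes scaleC :: "'k::field_char_0 \<Rightarrow> 'c::comm_ring_1 \<Rightarrow> 'c"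
    and scaleS :: "'k \<Rightarrow> 's::ring_1 \<Rightarrow> 's"
    and \<iota> :: "'c \<Rightarrow> 's"
    and \<Delta> :: "'c \<Rightarrow> 's \<Rightarrow> 's"
    and tr :: "'s \<Rightarrow> 'c"
  assumes order: "poisson_order scaleC scaleS \<iota> \<Delta>"
    and trace: "trace_map \<iota> tr"
    and commutes: "\<forall>\<delta>. derivation scaleS \<delta> \<and> preserves_subalgebra \<iota> \<delta> \<longrightarrow>
                       trace_commutes \<iota> tr \<delta>"
  shows
    "(\<forall>ys. module_basis \<iota> ys \<longrightarrow>
        poisson_normal (order_bracket \<iota> \<Delta>) (free_discriminant \<iota> ys) \<and>
        (factorial_domain (class_ring :: 'c ring) \<or>
         noetherian_poisson_ufd (order_bracket \<iota> \<Delta>) \<longrightarrow>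
           free_discriminant \<iota> ys = 0 \<or>
           (\<exists>u ps. u dvd 1 \<and> (\<forall>p\<in>set ps. poisson_prime (order_bracket \<iota> \<Delta>) p) \<and>
                   free_discriminant \<iota> ys = u * prod_list ps))) \<and>
     (\<forall>n>0.
        poisson_ideal (order_bracket \<iota> \<Delta>) (discriminant_ideal tr n) \<and>
        poisson_ideal (order_bracket \<iota> \<Delta>) (modified_discriminant_ideal tr n) \<and>
        (\<forall>\<delta>. derivation scaleS \<delta> \<and> preserves_subalgebra \<iota> \<delta> \<longrightarrow>
             \<delta> ` \<iota> ` discriminant_ideal tr n \<subseteq> \<iota> ` discriminant_ideal tr n \<and>
             \<delta> ` \<iota> ` modified_discriminant_ideal tr n \<subseteq> \<iota> ` modified_discriminant_ideal tr n))"
proof -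
  interpret poisson_order scaleC scaleS \<iota> \<Delta> by (rule order)
  interpret P: poisson_algebra_char_0 scaleC "order_bracket \<iota> \<Delta>"
    using poisson by (rule poisson_algebra_char_0.intro)
  have normal: "poisson_normal (order_bracket \<iota> \<Delta>) (free_discriminant \<iota> ys)" if "module_basis \<iota> ys" for ys
    unfolding P.poisson_normal_iff
    using free_discriminant_derivation[OF that \<Delta>_derivation \<Delta>_preserves]
    by (simp add: order_bracket_eq)
  \<comment> \<open>Stated for all derivations preserving \<open>C\<close>; the case
    \<open>\<Delta> z\<close> gives stability under the bracket with \<open>z\<close>.\<close>
  have stable: "induced_derivation \<iota> \<delta> x \<in> discriminant_ideal tr n"
      if "derivation scaleS \<delta>" "preserves_subalgebra \<iota> \<delta>" "x \<in> discriminant_ideal tr n" for \<delta> x n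
    using trace commutes that
    by (intro comm_ring_derivation.discriminant_ideal_stable[OF induced_derivation, of \<delta> \<delta> tr])
      (auto simp: derivation_mult trace_map_add trace_map_def induced_derivation_trace)
  have stable': "induced_derivation \<iota> \<delta> x \<in> modified_discriminant_ideal tr n"
      if "derivation scaleS \<delta>" "preserves_subalgebra \<iota> \<delta>" "x \<in> modified_discriminant_ideal tr n" for \<delta> x n
    using trace commutes that
    by (intro comm_ring_derivation.modified_discriminant_ideal_stable[OF induced_derivation, of \<delta> \<delta> tr])
      (auto simp: derivation_mult trace_map_add induced_derivation_trace)
  show ?thesis
  proof (intro conjI allI impI)
    fix ys assume basis: "module_basis \<iota> ys"
    show "poisson_normal (order_bracket \<iota> \<Delta>) (free_discriminant \<iota> ys)" by (rule normal[OF basis])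
    assume "factorial_domain (class_ring :: 'c ring) \<or> noetherian_poisson_ufd (order_bracket \<iota> \<Delta>)"
    then show "free_discriminant \<iota> ys = 0 \<or>
           (\<exists>u ps. u dvd 1 \<and> (\<forall>p\<in>set ps. poisson_prime (order_bracket \<iota> \<Delta>) p) \<and>
                   free_discriminant \<iota> ys = u * prod_list ps)"
      using P.factorial_domain_factorization[OF _ normal[OF basis]]
        P.noetherian_poisson_ufd_factorization[OF _ normal[OF basis]] by blast
  next
    fix n :: nat
    show "poisson_ideal (order_bracket \<iota> \<Delta>) (discriminant_ideal tr n)"
      unfolding P.poisson_ideal_iff discriminant_ideal_def
      using stable[OF \<Delta>_derivation \<Delta>_preserves, unfolded discriminant_ideal_def]
      by (simp add: ideal_genideal_class_ring order_bracket_eq)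
    show "poisson_ideal (order_bracket \<iota> \<Delta>) (modified_discriminant_ideal tr n)"
      unfolding P.poisson_ideal_iff modified_discriminant_ideal_def
      using stable'[OF \<Delta>_derivation \<Delta>_preserves, unfolded modified_discriminant_ideal_def]
      by (simp add: ideal_genideal_class_ring order_bracket_eq)
  next
    fix n :: nat and \<delta> assume "derivation scaleS \<delta> \<and> preserves_subalgebra \<iota> \<delta>"
    then have \<delta>: "derivation scaleS \<delta>" "preserves_subalgebra \<iota> \<delta>" by auto
    show "\<delta> ` \<iota> ` discriminant_ideal tr n \<subseteq> \<iota> ` discriminant_ideal tr n"
      using stable[OF \<delta>] by (auto simp flip: iota_induced_derivation[OF \<delta>(2)])
    show "\<delta> ` \<iota> ` modified_discriminant_ideal tr n \<subseteq> \<iota> ` modified_discriminant_ideal tr n"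
      using stable'[OF \<delta>] by (auto simp flip: iota_induced_derivation[OF \<delta>(2)])
  qed
qed

end
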